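(* Let $M_1$ and $M_2$ be two similar Hermitian $n\times n$ matrices and let $v_1,v_2\in\mathbb{C}^n$. The following are equivalent: (a) $v_1v_1^*-M_1$ and $v_2v_2^*-M_2$ are similar; (b) $v_1^*(tI-M_1)^{-1}v_1=v_2^*(tI-M_2)^{-1}v_2$ (as functions of $t$); (c) there exists a unitary matrix $U$ such that $UM_1=M_2U$ and $Uv_1=v_2$. Furthermore, if $M_1,M_2,v_1,v_2$ are all real, then the unitary matrix $U$ in (c) can be chosen to be real orthogonal. *)

theory Defs
  imports
    Complex_Main
    "Jordan_Normal_Form.Gauss_Jordan_Elimination"
    "Jordan_Normal_Form.Schur_Decomposition"
begin

definition hermitian_mat :: "complex mat \<Rightarrow> bool" where
  "hermitian_mat A \<longleftrightarrow> square_mat A \<and> mat_adjoint A = A"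

definition unitary_mat :: "complex mat \<Rightarrow> bool" where
  "unitary_mat U \<longleftrightarrow> square_mat U \<and> inverts_mat U (mat_adjoint U) \<and> inverts_mat (mat_adjoint U) U"

(* The library predicate orthogonal_mat only asks for nonzero, pairwise orthogonal columns,
   not for orthonormal ones, so it is not the notion of an orthogonal matrix meant here. *)
definition real_orthogonal_mat :: "complex mat \<Rightarrow> bool" where
  "real_orthogonal_mat U \<longleftrightarrow> square_mat U \<and> elements_mat U \<subseteq> \<real> \<and>
     inverts_mat U (transpose_mat U) \<and> inverts_mat (transpose_mat U) U"

(* the matrix v w^* *)
definition outer_prod :: "complex vec \<Rightarrow> complex vec \<Rightarrow> complex mat" where
  "outer_prod v w = mat (dim_vec v) (dim_vec w) (\<lambda>(i, j). v $ i * cnj (w $ j))"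

definition char_mat_at :: "complex mat \<Rightarrow> complex \<Rightarrow> complex mat" where
  "char_mat_at M t = t \<cdot>\<^sub>m 1\<^sub>m (dim_row M) - M"

(* v^* (t I - M)^{-1} v; the operation \<bullet>c conjugates its second argument.
   Only meaningful where t I - M is invertible. *)
definition resolvent_form :: "complex mat \<Rightarrow> complex vec \<Rightarrow> complex \<Rightarrow> complex" where
  "resolvent_form M v t = (the (mat_inverse (char_mat_at M t)) *\<^sub>v v) \<bullet>c v"

end

theory Submission
  imports Defs
begin

text \<open>
  The implications run (c) to (a) to (b) to (c). A unitary intertwiner conjugates one rank-one
  perturbation into the other. If the perturbations are similar, their characteristic polynomials
  agree, and the matrix determinant lemma turns the quotient by the common characteristic polynomial
  of \<open>M\<^sub>1\<close> and \<open>M\<^sub>2\<close> into the resolvent form. Conversely, diagonalise both matrices unitarily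
  to the same diagonal matrix. The resolvent form is then the partial fraction with numerators
  \<open>\<bar>w\<^sub>k\<bar>\<^sup>2\<close> for the coordinates \<open>w\<^sub>k\<close> of the vector in the eigenbasis, so comparing residues shows that
  the two coordinate vectors have equal norms on every eigenspace. A reflection within each
  eigenspace maps the one to the other and commutes with the diagonal matrix. For real data the
  eigenbases and the reflection can be taken real, hence so is the resulting intertwiner.
\<close>

section \<open>Adjoints, unitary matrices and real matrices\<close>

lemma mat_adjoint_dim [simp]:
  "dim_row (mat_adjoint A) = dim_col A" "dim_col (mat_adjoint A) = dim_row A"
  by (auto simp: mat_adjoint_def)

lemma mat_adjoint_carrier [simp]:
  "A \<in> carrier_mat nr nc \<Longrightarrow> mat_adjoint A \<in> carrier_mat nc nr"
  by (rule carrier_matI) auto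

lemma mat_adjoint_index [simp]:
  fixes A :: "complex mat"
  assumes "i < dim_col A" "j < dim_row A"
  shows "mat_adjoint A $$ (i, j) = cnj (A $$ (j, i))"
  using assms by (simp add: mat_adjoint_def mat_of_rows_def)

lemma mat_adjoint_adjoint [simp]: "mat_adjoint (mat_adjoint A) = (A :: complex mat)"
  by (rule eq_matI) auto

lemma mat_adjoint_mult:
  fixes A B :: "complex mat"
  assumes "A \<in> carrier_mat nr n" "B \<in> carrier_mat n nc"
  shows "mat_adjoint (A * B) = mat_adjoint B * mat_adjoint A"
  using assms by (intro eq_matI) (auto simp: scalar_prod_def mult.commute)

lemma mult_mat_vec_cscalar_prod:
  fixes A :: "complex mat"
  assumes A: "A \<in> carrier_mat nr nc" and x: "x \<in> carrier_vec nc" and y: "y \<in> carrier_vec nr"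
  shows "(A *\<^sub>v x) \<bullet>c y = x \<bullet>c (mat_adjoint A *\<^sub>v y)"
proof -
  have "(A *\<^sub>v x) \<bullet>c y = (\<Sum>i<nr. \<Sum>j<nc. A $$ (i, j) * x $ j * cnj (y $ i))"
    using assms by (simp add: scalar_prod_def atLeast0LessThan sum_distrib_right)
  also have "\<dots> = (\<Sum>j<nc. \<Sum>i<nr. A $$ (i, j) * x $ j * cnj (y $ i))"
    by (rule sum.swap)
  also have "\<dots> = x \<bullet>c (mat_adjoint A *\<^sub>v y)"
    using assms by (simp add: scalar_prod_def atLeast0LessThan sum_distrib_left mult_ac)
  finally show ?thesis .
qed

text \<open>For square matrices a right inverse is also a left inverse, so one of the two products
  settles unitarity.\<close>

lemma unitary_matI:
  assumes "U \<in> carrier_mat n n" "U * mat_adjoint U = 1\<^sub>m n"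
  shows "unitary_mat U"
  using assms mat_mult_left_right_inverse[of U n "mat_adjoint U"]
  by (auto simp: unitary_mat_def inverts_mat_def)

lemma unitary_matD:
  assumes "unitary_mat U" "U \<in> carrier_mat n n"
  shows "U * mat_adjoint U = 1\<^sub>m n" "mat_adjoint U * U = 1\<^sub>m n"
  using assms by (auto simp: unitary_mat_def inverts_mat_def)

lemma unitary_mat_adjoint:
  assumes "unitary_mat U" "U \<in> carrier_mat n n"
  shows "unitary_mat (mat_adjoint U)"
  using unitary_matD[OF assms] assms(2) by (intro unitary_matI) auto

lemma unitary_mat_mult:
  assumes U: "unitary_mat U" "U \<in> carrier_mat n n" and V: "unitary_mat V" "V \<in> carrier_mat n n"
  shows "unitary_mat (U * V)"
proof (rule unitary_matI)
  have "U * V * mat_adjoint (U * V) = U * (V * mat_adjoint V) * mat_adjoint U"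
    using U(2) V(2)
    by (simp add: mat_adjoint_mult[OF U(2) V(2)] assoc_mult_mat[of _ n n _ n _ n]
        mult_carrier_mat[of _ n n _ n])
  then show "U * V * mat_adjoint (U * V) = 1\<^sub>m n"
    using unitary_matD[OF U] unitary_matD[OF V] U(2) by simp
qed (use U V in auto)

section \<open>Complex matrices with real entries\<close>

lemma real_matI:
  assumes "A \<in> carrier_mat nr nc" "\<And>i j. i < nr \<Longrightarrow> j < nc \<Longrightarrow> A $$ (i, j) \<in> \<real>"
  shows "elements_mat A \<subseteq> (\<real> :: complex set)"
  using assms by auto

lemma real_matD:
  assumes "elements_mat A \<subseteq> (\<real> :: complex set)" "i < dim_row A" "j < dim_col A"
  shows "A $$ (i, j) \<in> \<real>"
  using assms by blast

lemma real_mat_adjoint: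
  assumes "elements_mat A \<subseteq> (\<real> :: complex set)"
  shows "elements_mat (mat_adjoint A) \<subseteq> \<real>"
  using assms
  by (intro real_matI[of _ "dim_col A" "dim_row A"])
    (auto simp: Reals_cnj_iff real_matD intro!: carrier_matI)

lemma real_mat_mult:
  assumes "elements_mat A \<subseteq> (\<real> :: complex set)" "elements_mat B \<subseteq> \<real>"
    and "A \<in> carrier_mat nr n" "B \<in> carrier_mat n nc"
  shows "elements_mat (A * B) \<subseteq> \<real>"
  using assms
  by (intro real_matI[of _ nr nc]) (auto simp: scalar_prod_def intro!: sum_in_Reals Reals_mult real_matD)

lemma real_mult_mat_vec:
  assumes "elements_mat A \<subseteq> (\<real> :: complex set)" "set\<^sub>v v \<subseteq> \<real>"
    and "A \<in> carrier_mat nr n" "v \<in> carrier_vec n"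
  shows "set\<^sub>v (A *\<^sub>v v) \<subseteq> \<real>"
  using assms
  by (auto elim!: vec_setE simp: scalar_prod_def subset_iff vec_setI intro!: sum_in_Reals Reals_mult real_matD)

section \<open>Block reflections\<close>

text \<open>On each level set of \<open>d\<close> this is the unitary reflection \<open>I - u u\<^sup>* / (u\<^sup>* x)\<close> with \<open>u = x - y\<close>; it needs
  no phase correction for complex vectors. On level sets where \<open>x\<close> and \<open>y\<close> agree, \<open>u = 0\<close> and division
  by zero yields the identity.\<close>

definition block_reflection ::
    "nat \<Rightarrow> (nat \<Rightarrow> complex) \<Rightarrow> complex vec \<Rightarrow> complex vec \<Rightarrow> complex mat" where
  "block_reflection n d x y = mat n n (\<lambda>(k, l). (if k = l then 1 else 0) -
     (if d k = d l then (x $ k - y $ k) * cnj (x $ l - y $ l) /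
        (\<Sum>m | m < n \<and> d m = d k. cnj (x $ m - y $ m) * x $ m) else 0))"

lemma block_reflection_carrier [simp]: "block_reflection n d x y \<in> carrier_mat n n"
  by (simp add: block_reflection_def)

lemma block_reflection_dim [simp]:
  "dim_row (block_reflection n d x y) = n" "dim_col (block_reflection n d x y) = n"
  by (simp_all add: block_reflection_def)

lemma block_reflection_real:
  assumes "x \<in> carrier_vec n" "y \<in> carrier_vec n" "set\<^sub>v x \<subseteq> \<real>" "set\<^sub>v y \<subseteq> \<real>"
  shows "elements_mat (block_reflection n d x y) \<subseteq> \<real>"
proof -
  have xy: "x $ i \<in> \<real>" "y $ i \<in> \<real>" if "i < n" for i
    using that assms vec_setI[of x i] vec_setI[of y i] by auto
  have cnj: "cnj (x $ i - y $ i) \<in> \<real>" if "i < n" for i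
    using Reals_diff[OF xy[OF that]] by (simp only: Reals_cnj_iff complex_cnj_cnj)
  show ?thesis
    by (intro real_matI[of _ n n])
      (auto simp: block_reflection_def xy cnj simp del: complex_cnj_diff
        intro!: Reals_diff Reals_mult Reals_divide sum_in_Reals)
qed

text \<open>Entry \<open>(k, l)\<close> is scaled by \<open>d l\<close> in one product and by
  \<open>d k\<close> in the other; where these differ, the entry itself is 0.\<close>

lemma block_reflection_commute:
  "block_reflection n d x y * mat_diag n d = mat_diag n d * block_reflection n d x y"
  by (simp add: mat_diag_mult_left[of _ n n] mat_diag_mult_right[of _ n n])
    (intro eq_matI; auto simp: block_reflection_def)

text \<open>On a level set with \<open>u = x - y\<close> and \<open>q = u* x\<close>, equal norms of
  \<open>x\<close> and \<open>y\<close> amount to \<open>u* u = q + cnj q\<close>. This identity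
  makes the cross terms of \<open>(I - u u* / q) (I - u u* / q)*\<close> cancel, while
  \<open>u (u* x) / q = u\<close> sends \<open>x\<close> to \<open>x - u = y\<close>.\<close>

lemma block_reflection_unitary:
  assumes norm: "\<And>c. (\<Sum>m | m < n \<and> d m = c. x $ m * cnj (x $ m)) =
                       (\<Sum>m | m < n \<and> d m = c. y $ m * cnj (y $ m))"
    and x: "x \<in> carrier_vec n" and y: "y \<in> carrier_vec n"
  shows "unitary_mat (block_reflection n d x y)" "block_reflection n d x y *\<^sub>v x = y"
proof -
  define u where "u k = x $ k - y $ k" for k
  define q where "q c = (\<Sum>m | m < n \<and> d m = c. cnj (u m) * x $ m)" for c
  define S where "S c = (\<Sum>m | m < n \<and> d m = c. u m * cnj (u m))" for c
  have Sq: "S c = q c + cnj (q c)" for c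
  proof -
    \<comment> \<open>Termwise, \<open>cnj u * x + u * cnj x - u * cnj u\<close> expands to
      \<open>x * cnj x - y * cnj y\<close>.\<close>
    have "q c + cnj (q c) - S c = (\<Sum>m | m < n \<and> d m = c. x $ m * cnj (x $ m) - y $ m * cnj (y $ m))"
      by (simp add: q_def S_def u_def sum.distrib[symmetric] sum_subtractf[symmetric] algebra_simps)
    also have "\<dots> = 0" using norm[of c] by (simp add: sum_subtractf)
    finally show ?thesis by simp
  qed
  define B where "B k l = (if d k = d l then u k * cnj (u l) / q (d k) else 0)" for k l
  have V: "block_reflection n d x y $$ (k, l) = (if k = l then 1 else 0) - B k l"
    if "k < n" "l < n" for k l
    using that by (simp add: block_reflection_def B_def u_def q_def)
  show "unitary_mat (block_reflection n d x y)"
  proof (rule unitary_matI)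
    show "block_reflection n d x y * mat_adjoint (block_reflection n d x y) = 1\<^sub>m n"
    proof (rule eq_matI)
      fix k m assume "k < dim_row (1\<^sub>m n :: complex mat)" "m < dim_col (1\<^sub>m n :: complex mat)"
      then have k: "k < n" and m: "m < n" by auto
      \<comment> \<open>The reflection is \<open>I - B\<close>, so unitarity reduces to
        \<open>B B* = B + B*\<close>.\<close>
      have BB: "(\<Sum>l<n. B k l * cnj (B m l)) = B k m + cnj (B m k)"
      proof (cases "d k = d m")
        case True
        have "(\<Sum>l<n. B k l * cnj (B m l)) =
              (\<Sum>l | l < n \<and> d l = d k. u k * cnj (u m) / (q (d k) * cnj (q (d k))) * (u l * cnj (u l)))"
          by (rule sum.mono_neutral_cong_right) (auto simp: B_def True)
        also have "\<dots> = u k * cnj (u m) / (q (d k) * cnj (q (d k))) * S (d k)"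
          by (simp add: S_def sum_distrib_left)
        also have "\<dots> = u k * cnj (u m) / q (d k) + u k * cnj (u m) / cnj (q (d k))"
          \<comment> \<open>Since \<open>S = q + cnj q\<close>, the factor
            \<open>S / (q * cnj q)\<close> splits into \<open>1 / cnj q + 1 / q\<close>. If
            \<open>q = 0\<close>, both sides are 0 by the convention for division.\<close>
          by (cases "q (d k) = 0") (simp_all add: Sq field_simps)
        also have "\<dots> = B k m + cnj (B m k)"
          using True by (simp add: B_def mult.commute)
        finally show ?thesis .
      qed (auto simp: B_def intro!: sum.neutral)
      have "(block_reflection n d x y * mat_adjoint (block_reflection n d x y)) $$ (k, m) =
        (\<Sum>l<n. ((if k = l then 1 else 0) - B k l) * cnj ((if m = l then 1 else 0) - B m l))"
        using k m by (simp add: scalar_prod_def atLeast0LessThan V)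
      also have "\<dots> = (\<Sum>l<n. (if l = k then (if m = l then 1 else 0) - cnj (B m l) else 0)
           - (if l = m then B k l else 0) + B k l * cnj (B m l))"
        by (rule sum.cong) (auto simp: algebra_simps)
      also have "\<dots> = (if m = k then 1 else 0) - cnj (B m k) - B k m + (\<Sum>l<n. B k l * cnj (B m l))"
        using k m by (simp add: sum.distrib sum_subtractf)
      finally show "(block_reflection n d x y * mat_adjoint (block_reflection n d x y)) $$ (k, m) =
          1\<^sub>m n $$ (k, m)"
        using k m by (auto simp: BB)
    qed auto
  qed simp
  show "block_reflection n d x y *\<^sub>v x = y"
  proof (rule eq_vecI)
    fix k assume "k < dim_vec y"
    then have k: "k < n" using y by simp
    have "(block_reflection n d x y *\<^sub>v x) $ k = (\<Sum>l<n. ((if k = l then 1 else 0) - B k l) * x $ l)"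
      using k x by (simp add: scalar_prod_def atLeast0LessThan V)
    also have "\<dots> = (\<Sum>l<n. (if l = k then x $ l else 0) - B k l * x $ l)"
      by (rule sum.cong) (auto simp: algebra_simps)
    also have "\<dots> = x $ k - (\<Sum>l<n. B k l * x $ l)"
      using k by (simp add: sum_subtractf)
    also have "(\<Sum>l<n. B k l * x $ l) = (\<Sum>l | l < n \<and> d l = d k. u k / q (d k) * (cnj (u l) * x $ l))"
      by (rule sum.mono_neutral_cong_right) (auto simp: B_def)
    also have "\<dots> = u k / q (d k) * q (d k)"
      by (simp add: q_def sum_distrib_left)
    also have "\<dots> = u k"
    proof (cases "q (d k) = 0")
      \<comment> \<open>A vanishing \<open>q\<close> forces \<open>S = 0\<close>, a sum of squared
        moduli; hence \<open>u\<close> is 0 on the level set and the default value of the quotient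
        is correct.\<close>
      case True
      then have "(\<Sum>m | m < n \<and> d m = d k. (cmod (u m))\<^sup>2) = 0"
        using Sq[of "d k"] unfolding S_def
        by (simp add: complex_norm_square[symmetric] flip: of_real_power of_real_sum)
      then have "u k = 0"
        using k by (subst (asm) sum_nonneg_eq_0_iff) auto
      then show ?thesis by simp
    qed simp
    finally show "(block_reflection n d x y *\<^sub>v x) $ k = y $ k"
      by (simp add: u_def)
  qed (use y in simp)
qed

section \<open>Resolvent forms and rank-one perturbations\<close>

text \<open>Multiply by \<open>t - c\<close> and let \<open>t\<close> tend to \<open>c\<close>: only
  the terms with pole \<open>c\<close> survive, and the limit is their total residue.\<close>

lemma partial_fractions_zero_imp_residues_zero:
  fixes a d :: "nat \<Rightarrow> complex"
  assumes zero: "\<And>t. t \<notin> d ` {..<n} \<Longrightarrow> (\<Sum>k<n. a k / (t - d k)) = 0"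
  shows "(\<Sum>k | k < n \<and> d k = c. a k) = 0"
proof -
  have "((\<lambda>t. (t - c) * a k / (t - d k)) \<longlongrightarrow> (if d k = c then a k else 0)) (at c)" for k
  proof (cases "d k = c")
    case True
    \<comment> \<open>The equation may fail at \<open>t = c\<close>, where the quotient is 0 by
      convention; the filter \<open>at c\<close> ignores that point.\<close>
    have "\<forall>\<^sub>F t in at c. a k = (t - c) * a k / (t - d k)"
      using True by (auto simp: eventually_at_filter)
    then have "((\<lambda>t. (t - c) * a k / (t - d k)) \<longlongrightarrow> a k) (at c)"
      by (rule tendsto_cong[THEN iffD1]) simp
    then show ?thesis using True by simp
  next
    case False
    then have "((\<lambda>t. (t - c) * a k / (t - d k)) \<longlongrightarrow> (c - c) * a k / (c - d k)) (at c)"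
      by (intro tendsto_intros) auto
    then show ?thesis using False by simp
  qed
  then have "((\<lambda>t. \<Sum>k<n. (t - c) * a k / (t - d k)) \<longlongrightarrow> (\<Sum>k<n. if d k = c then a k else 0)) (at c)"
    by (rule tendsto_sum)
  moreover have "\<forall>\<^sub>F t in at c. (\<Sum>k<n. (t - c) * a k / (t - d k)) = 0"
  proof -
    \<comment> \<open>The point \<open>c\<close> may itself be a pole. It is taken out of the
      excluded finite set so that the complement is an open neighbourhood of \<open>c\<close>; the
      condition \<open>t \<noteq> c\<close> is added separately.\<close>
    have "\<forall>\<^sub>F t in at c. t \<in> - (d ` {..<n} - {c})"
      by (intro eventually_at_in_open' open_Compl finite_imp_closed) auto
    moreover have "\<forall>\<^sub>F t in at c. t \<noteq> c"
      by (simp add: eventually_at_filter)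
    ultimately show ?thesis
    proof eventually_elim
      case (elim t)
      then have "(t - c) * (\<Sum>k<n. a k / (t - d k)) = 0" by (subst zero) auto
      then show ?case by (simp add: sum_distrib_left)
    qed
  qed
  ultimately have "((\<lambda>t. 0) \<longlongrightarrow> (\<Sum>k<n. if d k = c then a k else 0)) (at c)"
    by (rule Lim_transform_eventually)
  then have "(\<Sum>k<n. if d k = c then a k else 0) = 0"
    by (simp add: tendsto_const_iff)
  also have "(\<Sum>k<n. if d k = c then a k else 0) = (\<Sum>k | k < n \<and> d k = c. a k)"
    by (rule sum.mono_neutral_cong_right) auto
  finally show ?thesis .
qed

section \<open>Invertibility and the resolvent as solution of a linear system\<close>

lemma invertible_mat_iff_det_nonzero:
  fixes A :: "complex mat"
  assumes A: "A \<in> carrier_mat n n"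
  shows "invertible_mat A \<longleftrightarrow> det A \<noteq> 0"
proof
  assume "invertible_mat A"
  then obtain B where AB: "A * B = 1\<^sub>m n" and BA: "B * A = 1\<^sub>m (dim_row B)"
    using A by (auto simp: invertible_mat_def inverts_mat_def)
  \<comment> \<open>\<open>invertible_mat\<close> does not fix the shape of the inverse; comparing
    column counts in the two products does.\<close>
  have "dim_col B = n" "dim_row B = n"
    using arg_cong[OF AB, of dim_col] arg_cong[OF BA, of dim_col] A by auto
  then have "B \<in> carrier_mat n n" by auto
  then show "det A \<noteq> 0"
    using det_mult[OF A, of B] AB by auto
next
  assume "det A \<noteq> 0"
  from det_non_zero_imp_unit[OF A this, of "()"] obtain B
    where "B \<in> carrier_mat n n" "A * B = 1\<^sub>m n" "B * A = 1\<^sub>m n"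
    by (auto simp: Units_def ring_mat_def)
  then show "invertible_mat A"
    using A by (auto simp: invertible_mat_def inverts_mat_def)
qed

lemma char_mat_at_carrier [simp]:
  "M \<in> carrier_mat n n \<Longrightarrow> char_mat_at M t \<in> carrier_mat n n"
  by (auto simp: char_mat_at_def)

text \<open>Replaces the computed inverse by a solution \<open>y\<close> of the linear system. The
  determinant lemma needs \<open>v\<close> in exactly this form, as the shifted matrix applied to a
  vector.\<close>

lemma resolvent_form_solution:
  assumes M: "M \<in> carrier_mat n n" and v: "v \<in> carrier_vec n"
    and inv: "invertible_mat (char_mat_at M t)"
  obtains y where "y \<in> carrier_vec n" "char_mat_at M t *\<^sub>v y = v" "resolvent_form M v t = y \<bullet>c v"
proof -
  let ?X = "char_mat_at M t"
  have X: "?X \<in> carrier_mat n n" using M by simp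
  have "?X \<in> Units (ring_mat TYPE(complex) n ())"
    using det_non_zero_imp_unit[OF X, of "()"] inv invertible_mat_iff_det_nonzero[OF X] by blast
  then obtain B where B: "mat_inverse ?X = Some B"
    using mat_inverse(1)[OF X, where b = "()"] by (cases "mat_inverse ?X") auto
  from mat_inverse(2)[OF X B] have XB: "?X * B = 1\<^sub>m n" and Bc: "B \<in> carrier_mat n n" by auto
  show thesis
  proof (rule that[of "B *\<^sub>v v"])
    show "?X *\<^sub>v (B *\<^sub>v v) = v"
      using XB v by (simp flip: assoc_mult_mat_vec[OF X Bc v])
  qed (use B Bc v in \<open>auto simp: resolvent_form_def\<close>)
qed

text \<open>An invertible matrix is injective, so any solution found by other means may stand in for
  the computed one; in the eigenbasis an explicit solution is at hand.\<close>

lemma resolvent_form_eq: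
  assumes M: "M \<in> carrier_mat n n" and v: "v \<in> carrier_vec n"
    and inv: "invertible_mat (char_mat_at M t)"
    and z: "z \<in> carrier_vec n" "char_mat_at M t *\<^sub>v z = v"
  shows "resolvent_form M v t = z \<bullet>c v"
proof -
  let ?X = "char_mat_at M t"
  have X: "?X \<in> carrier_mat n n" using M by simp
  obtain y where y: "y \<in> carrier_vec n" "?X *\<^sub>v y = v" "resolvent_form M v t = y \<bullet>c v"
    using resolvent_form_solution[OF M v inv] .
  obtain B where B: "B \<in> carrier_mat n n" "B * ?X = 1\<^sub>m n"
    using det_non_zero_imp_unit[OF X, of "()"] inv invertible_mat_iff_det_nonzero[OF X]
    by (auto simp: Units_def ring_mat_def)
  have "y = B *\<^sub>v (?X *\<^sub>v y)" "z = B *\<^sub>v (?X *\<^sub>v z)"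
    using y(1) z(1) B by (simp_all flip: assoc_mult_mat_vec[OF B(1) X])
  then have "y = z" using y(2) z(2) by simp
  then show ?thesis using y(3) by simp
qed

section \<open>Rank-one perturbations and their determinants\<close>

lemma outer_prod_carrier [simp]:
  "v \<in> carrier_vec n \<Longrightarrow> w \<in> carrier_vec m \<Longrightarrow> outer_prod v w \<in> carrier_mat n m"
  by (auto simp: outer_prod_def)

lemma outer_prod_dim [simp]:
  "dim_row (outer_prod v w) = dim_vec v" "dim_col (outer_prod v w) = dim_vec w"
  by (auto simp: outer_prod_def)

text \<open>Both sides are the determinant of the bordered matrix with blocks
  \<open>A\<close>, \<open>A y\<close>, \<open>- w\<^sup>*\<close>, \<open>1\<close>, eliminated once by columns and once by rows.\<close>

lemma det_rank_one_update:
  assumes A: "A \<in> carrier_mat n n" and y: "y \<in> carrier_vec n" and w: "w \<in> carrier_vec n"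
  shows "det (A + outer_prod (A *\<^sub>v y) w) = det A * (1 + y \<bullet>c w)"
proof -
  let ?v = "A *\<^sub>v y"
  define C where "C = mat n 1 (\<lambda>(i, _). ?v $ i)"
  define Y where "Y = mat n 1 (\<lambda>(i, _). y $ i)"
  define R where "R = mat 1 n (\<lambda>(_, j). - cnj (w $ j))"
  \<comment> \<open>This is the Schur complement \<open>1 - R A^{-1} C\<close> of \<open>A\<close>
    in the bordered matrix, with \<open>Y\<close> in place of \<open>A^{-1} C\<close>.\<close>
  define s where "s = mat 1 1 (\<lambda>_. 1 + y \<bullet>c w)"
  let ?z = "0\<^sub>m n 1 :: complex mat" and ?z' = "0\<^sub>m 1 n :: complex mat"
  define G where "G = A + outer_prod ?v w"
  have c: "C \<in> carrier_mat n 1" "Y \<in> carrier_mat n 1" "R \<in> carrier_mat 1 n" "s \<in> carrier_mat 1 1"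
    by (auto simp: C_def Y_def R_def s_def)
  have G: "G \<in> carrier_mat n n" using A y w by (auto simp: G_def)
  have GC: "G + C * R = A"
    using A y w by (intro eq_matI) (auto simp: G_def C_def R_def outer_prod_def scalar_prod_def)
  have AY: "A * Y = C"
    using A y by (intro eq_matI) (auto simp: C_def Y_def scalar_prod_def)
  have RY: "R * Y + s = 1\<^sub>m 1"
    using y w by (intro eq_matI) (auto simp: R_def Y_def s_def scalar_prod_def sum_negf mult.commute)
  have dets: "det s = 1 + y \<bullet>c w" using det_single[OF c(4)] by (simp add: s_def)
  have "four_block_mat G C ?z' (1\<^sub>m 1) * four_block_mat (1\<^sub>m n) ?z R (1\<^sub>m 1)
      = four_block_mat (G * 1\<^sub>m n + C * R) (G * ?z + C * 1\<^sub>m 1) (?z' * 1\<^sub>m n + 1\<^sub>m 1 * R) (?z' * ?z + 1\<^sub>m 1 * 1\<^sub>m 1)"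
    by (rule mult_four_block_mat[of _ n n _ 1 _ 1]) (use c G in auto)
  also have "\<dots> = four_block_mat A C R (1\<^sub>m 1)"
    using G c GC by simp
  also have "\<dots> = four_block_mat (A * 1\<^sub>m n + ?z * ?z') (A * Y + ?z * 1\<^sub>m 1) (R * 1\<^sub>m n + s * ?z') (R * Y + s * 1\<^sub>m 1)"
    using A c AY RY by simp
  also have "\<dots> = four_block_mat A ?z R s * four_block_mat (1\<^sub>m n) Y ?z' (1\<^sub>m 1)"
    by (rule mult_four_block_mat[of _ n n _ 1 _ 1, symmetric]) (use c A in auto)
  finally have eq: "four_block_mat G C ?z' (1\<^sub>m 1) * four_block_mat (1\<^sub>m n) ?z R (1\<^sub>m 1)
    = four_block_mat A ?z R s * four_block_mat (1\<^sub>m n) Y ?z' (1\<^sub>m 1)" .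
  have "det (four_block_mat G C ?z' (1\<^sub>m 1) * four_block_mat (1\<^sub>m n) ?z R (1\<^sub>m 1)) =
    det (four_block_mat G C ?z' (1\<^sub>m 1)) * det (four_block_mat (1\<^sub>m n) ?z R (1\<^sub>m 1))"
    by (rule det_mult[of _ "n + 1"]) (use G in auto)
  also have "det (four_block_mat G C ?z' (1\<^sub>m 1)) = det G * det (1\<^sub>m 1 :: complex mat)"
    by (rule det_four_block_mat_lower_left_zero[OF G c(1) refl]) simp
  also have "det (four_block_mat (1\<^sub>m n) ?z R (1\<^sub>m 1)) = det (1\<^sub>m n :: complex mat) * det (1\<^sub>m 1 :: complex mat)"
    by (rule det_four_block_mat_upper_right_zero[OF _ refl c(3)]) simp_all
  finally have 1: "det (four_block_mat G C ?z' (1\<^sub>m 1) * four_block_mat (1\<^sub>m n) ?z R (1\<^sub>m 1)) = det G"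
    by simp
  have "det (four_block_mat A ?z R s * four_block_mat (1\<^sub>m n) Y ?z' (1\<^sub>m 1)) =
    det (four_block_mat A ?z R s) * det (four_block_mat (1\<^sub>m n) Y ?z' (1\<^sub>m 1))"
    by (rule det_mult[of _ "n + 1"]) (use A c in auto)
  also have "det (four_block_mat A ?z R s) = det A * det s"
    by (rule det_four_block_mat_upper_right_zero[OF A refl c(3,4)])
  also have "det (four_block_mat (1\<^sub>m n) Y ?z' (1\<^sub>m 1)) = det (1\<^sub>m n :: complex mat) * det (1\<^sub>m 1 :: complex mat)"
    by (rule det_four_block_mat_lower_left_zero[OF _ c(2) refl]) simp_all
  finally show ?thesis using 1 eq dets by (simp add: G_def)
qed

text \<open>Conjugation fixes scalar matrices, so the shifted matrices are again similar. The factor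
  \<open>s\<close> covers both uses: \<open>s = - 1\<close> gives \<open>char_mat_at\<close>, and
  \<open>s = 1\<close> gives the shifted perturbation.\<close>

lemma similar_mat_imp_det_shift_eq:
  fixes A B :: "complex mat"
  assumes sim: "similar_mat A B" and A: "A \<in> carrier_mat n n"
  shows "det (t \<cdot>\<^sub>m 1\<^sub>m n + s \<cdot>\<^sub>m A) = det (t \<cdot>\<^sub>m 1\<^sub>m n + s \<cdot>\<^sub>m B)"
proof (rule det_similar)
  obtain P Q where "similar_mat_wit A B P Q" using sim by (auto simp: similar_mat_def)
  note wit = similar_mat_witD2[OF A this]
  have "t \<cdot>\<^sub>m 1\<^sub>m n + s \<cdot>\<^sub>m A = P * (t \<cdot>\<^sub>m 1\<^sub>m n + s \<cdot>\<^sub>m B) * Q"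
  proof -
    have "P * (t \<cdot>\<^sub>m 1\<^sub>m n + s \<cdot>\<^sub>m B) = P * (t \<cdot>\<^sub>m 1\<^sub>m n) + P * (s \<cdot>\<^sub>m B)"
      by (rule mult_add_distrib_mat[of _ n n _ n]) (use wit in auto)
    also have "\<dots> = t \<cdot>\<^sub>m P + s \<cdot>\<^sub>m (P * B)"
      using wit by (simp add: mult_smult_distrib[of _ n n _ n])
    also have "\<dots> * Q = (t \<cdot>\<^sub>m P) * Q + (s \<cdot>\<^sub>m (P * B)) * Q"
      by (rule add_mult_distrib_mat[of _ n n _ _ n]) (use wit in auto)
    also have "\<dots> = t \<cdot>\<^sub>m (P * Q) + s \<cdot>\<^sub>m (P * B * Q)"
      using wit by (simp add: mult_smult_assoc_mat[of _ n n _ n])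
    finally show ?thesis using wit by simp
  qed
  then show "similar_mat (t \<cdot>\<^sub>m 1\<^sub>m n + s \<cdot>\<^sub>m A) (t \<cdot>\<^sub>m 1\<^sub>m n + s \<cdot>\<^sub>m B)"
    using wit by (intro similar_matI[of _ _ P Q n]) auto
qed

text \<open>From \<open>t I + (v v* - M) = (t I - M) + v v*\<close> the determinant lemma gives
  \<open>det (t I - M) * (1 + resolvent_form M v t)\<close>. Both this product and its first factor
  agree for the two pairs, and the first factor is nonzero.\<close>

lemma similar_rank_one_imp_resolvent_form_eq:
  assumes M: "M1 \<in> carrier_mat n n" "M2 \<in> carrier_mat n n"
    and v: "v1 \<in> carrier_vec n" "v2 \<in> carrier_vec n"
    and sim: "similar_mat M1 M2" "similar_mat (outer_prod v1 v1 - M1) (outer_prod v2 v2 - M2)"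
    and inv: "invertible_mat (char_mat_at M1 t)" "invertible_mat (char_mat_at M2 t)"
  shows "resolvent_form M1 v1 t = resolvent_form M2 v2 t"
proof -
  have char: "char_mat_at M t = t \<cdot>\<^sub>m 1\<^sub>m n + (- 1) \<cdot>\<^sub>m M" if "M \<in> carrier_mat n n" for M
    using that by (intro eq_matI) (auto simp: char_mat_at_def)
  have det: "det (t \<cdot>\<^sub>m 1\<^sub>m n + 1 \<cdot>\<^sub>m (outer_prod v v - M)) =
      det (char_mat_at M t) * (1 + resolvent_form M v t)"
    if M: "M \<in> carrier_mat n n" and v: "v \<in> carrier_vec n"
      and inv: "invertible_mat (char_mat_at M t)" for M v
  proof -
    obtain y where y: "y \<in> carrier_vec n" "char_mat_at M t *\<^sub>v y = v"
      "resolvent_form M v t = y \<bullet>c v"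
      using resolvent_form_solution[OF M v inv] .
    have "t \<cdot>\<^sub>m 1\<^sub>m n + 1 \<cdot>\<^sub>m (outer_prod v v - M) = char_mat_at M t + outer_prod v v"
      using M v by (intro eq_matI) (auto simp: char_mat_at_def)
    then show ?thesis
      using det_rank_one_update[OF char_mat_at_carrier[OF M] y(1) v, of t] y(2,3) by simp
  qed
  have "det (char_mat_at M1 t) = det (char_mat_at M2 t)"
    using similar_mat_imp_det_shift_eq[OF sim(1) M(1)] by (simp add: char M)
  moreover have "det (char_mat_at M1 t) \<noteq> 0"
    using inv(1) invertible_mat_iff_det_nonzero char_mat_at_carrier M(1) by blast
  moreover have "outer_prod v1 v1 - M1 \<in> carrier_mat n n" using M v by auto
  note similar_mat_imp_det_shift_eq[OF sim(2) this, of t 1]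
  ultimately show ?thesis
    using det[OF M(1) v(1) inv(1)] det[OF M(2) v(2) inv(2)] by simp
qed

text \<open>\<open>t I - M = W diag(t - d k) W*\<close> is inverted entrywise on the diagonal, and
  moving \<open>W\<close> across the inner product turns \<open>v\<close> into \<open>w\<close>.
  Invertibility is part of the conclusion because equality of resolvent forms is only available at
  such \<open>t\<close>.\<close>

lemma resolvent_form_diagonalized:
  assumes M: "M \<in> carrier_mat n n" and W: "W \<in> carrier_mat n n" "unitary_mat W"
    and diag: "M * W = W * mat_diag n d" and v: "v \<in> carrier_vec n"
    and t: "t \<notin> d ` {..<n}"
  defines "w \<equiv> mat_adjoint W *\<^sub>v v"
  shows "invertible_mat (char_mat_at M t)"
    and "resolvent_form M v t = (\<Sum>k<n. w $ k * cnj (w $ k) / (t - d k))"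
proof -
  let ?X = "char_mat_at M t"
  let ?E = "mat_diag n (\<lambda>k. 1 / (t - d k))"
  let ?T = "mat_diag n (\<lambda>k. t - d k)"
  have X: "?X \<in> carrier_mat n n" using M by simp
  have E: "?E \<in> carrier_mat n n" and T: "?T \<in> carrier_mat n n" by simp_all
  have Wa: "mat_adjoint W \<in> carrier_mat n n" using W(1) by simp
  have XW: "?X * W = W * ?T"
  proof -
    have "?X * W = t \<cdot>\<^sub>m W - M * W"
      using M W(1) by (simp add: char_mat_at_def minus_mult_distrib_mat[of _ n n _ _ n]
          mult_smult_assoc_mat[of _ n n _ n])
    also have "\<dots> = W * ?T"
      using W(1) by (simp add: diag mat_diag_mult_right[OF W(1)]) (intro eq_matI; auto simp: algebra_simps)
    finally show ?thesis .
  qed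
  have "t \<noteq> d k" if "k < n" for k using t that by auto
  then have TE: "?T * ?E = 1\<^sub>m n"
    by (simp, intro eq_matI) (auto simp: mat_diag_def)
  have WEW: "W * ?E * mat_adjoint W \<in> carrier_mat n n" using W(1) E Wa by auto
  have "?X * (W * ?E * mat_adjoint W) = (?X * W) * ?E * mat_adjoint W"
    using X W(1) E Wa by (simp add: assoc_mult_mat[of _ n n _ n _ n])
  also have "\<dots> = W * (?T * ?E) * mat_adjoint W"
    unfolding XW using W(1) E T Wa by (simp add: assoc_mult_mat[of _ n n _ n _ n] del: mat_diag_diag)
  also have "\<dots> = 1\<^sub>m n"
    unfolding TE using W(1) unitary_matD[OF W(2,1)] by simp
  finally have XI: "?X * (W * ?E * mat_adjoint W) = 1\<^sub>m n" .
  then have "det ?X \<noteq> 0"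
    using det_mult[OF X WEW] by auto
  then show inv: "invertible_mat ?X" using invertible_mat_iff_det_nonzero[OF X] by simp
  have w: "w \<in> carrier_vec n" using Wa v by (simp add: w_def)
  have z: "W *\<^sub>v (?E *\<^sub>v w) \<in> carrier_vec n"
    using mult_mat_vec_carrier[OF W(1) mult_mat_vec_carrier[OF E w]] .
  have "(W * ?E * mat_adjoint W) *\<^sub>v v = W *\<^sub>v (?E *\<^sub>v w)"
    using W(1) E Wa v by (simp add: w_def assoc_mult_mat_vec[of _ n n _ n] mult_carrier_mat[of _ n n _ n]
        mult_mat_vec_carrier[of _ n n])
  moreover have "?X *\<^sub>v ((W * ?E * mat_adjoint W) *\<^sub>v v) = v"
    using XI v by (simp flip: assoc_mult_mat_vec[OF X WEW v])
  ultimately have "resolvent_form M v t = (W *\<^sub>v (?E *\<^sub>v w)) \<bullet>c v"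
    by (intro resolvent_form_eq[OF M v inv z]) simp
  also have "\<dots> = (?E *\<^sub>v w) \<bullet>c w"
    using mult_mat_vec_cscalar_prod[OF W(1) mult_mat_vec_carrier[OF E w] v] by (simp flip: w_def)
  also have "\<dots> = (\<Sum>k<n. (?E *\<^sub>v w) $ k * cnj (w $ k))"
    using w by (simp add: scalar_prod_def atLeast0LessThan)
  also have "\<dots> = (\<Sum>k<n. w $ k * cnj (w $ k) / (t - d k))"
  proof (rule sum.cong)
    fix k assume k: "k \<in> {..<n}"
    then have "(?E *\<^sub>v w) $ k = (\<Sum>l<n. (if k = l then 1 / (t - d l) else 0) * w $ l)"
      using w by (simp add: mat_diag_def scalar_prod_def atLeast0LessThan)
    also have "\<dots> = (\<Sum>l<n. if l = k then w $ l / (t - d l) else 0)"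
      by (rule sum.cong) auto
    finally have "(?E *\<^sub>v w) $ k = (\<Sum>l<n. if l = k then w $ l / (t - d l) else 0)" .
    then show "(?E *\<^sub>v w) $ k * cnj (w $ k) = w $ k * cnj (w $ k) / (t - d k)"
      using k by simp
  qed simp
  finally show "resolvent_form M v t = (\<Sum>k<n. w $ k * cnj (w $ k) / (t - d k))" .
qed

section \<open>Diagonalization of Hermitian matrices\<close>

lemma hermitian_mat_index:
  assumes "hermitian_mat A" "i < dim_row A" "j < dim_col A"
  shows "A $$ (i, j) = cnj (A $$ (j, i))"
  using assms mat_adjoint_index[of i A j] by (simp add: hermitian_mat_def)

lemma cscalar_prod_self_eq_norm:
  fixes v :: "complex vec"
  shows "v \<bullet>c v = complex_of_real (\<Sum>i<dim_vec v. (cmod (v $ i))\<^sup>2)"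
  by (simp add: scalar_prod_def atLeast0LessThan flip: complex_norm_square)

lemma hermitian_mat_eigenvalue_real:
  assumes A: "A \<in> carrier_mat n n" "hermitian_mat A" and ev: "eigenvector A v e"
  shows "e \<in> \<real>"
proof -
  have v: "v \<in> carrier_vec n" "v \<noteq> 0\<^sub>v n" and Av: "A *\<^sub>v v = e \<cdot>\<^sub>v v"
    using ev A by (auto simp: eigenvector_def)
  have "e * (v \<bullet>c v) = (A *\<^sub>v v) \<bullet>c v"
    using v by (simp add: Av)
  also have "\<dots> = v \<bullet>c (A *\<^sub>v v)"
    using mult_mat_vec_cscalar_prod[OF A(1) v(1) v(1)] A(2) by (simp add: hermitian_mat_def)
  also have "\<dots> = cnj e * (v \<bullet>c v)"
    using v by (simp add: Av conjugate_smult_vec)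
  finally have "e = cnj e"
    using v by simp
  then show ?thesis by (simp add: Reals_cnj_iff)
qed

text \<open>A real-linear \<open>f\<close> applied coordinatewise commutes with a real matrix and
  with a real scalar. It is used with the real and the imaginary part.\<close>

lemma real_mat_eigenvector_map:
  assumes A: "A \<in> carrier_mat n n" "elements_mat A \<subseteq> (\<real> :: complex set)" and e: "e \<in> \<real>"
    and v: "v \<in> carrier_vec n" and Av: "A *\<^sub>v v = e \<cdot>\<^sub>v v"
    and f: "\<And>x y. f (x + y) = f x + f y" "\<And>a x. a \<in> \<real> \<Longrightarrow> f (a * x) = a * f x"
  shows "A *\<^sub>v map_vec f v = e \<cdot>\<^sub>v map_vec f v"
proof (rule eq_vecI)
  fix i assume "i < dim_vec (e \<cdot>\<^sub>v map_vec f v)"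
  then have i: "i < n" using v by simp
  have f0: "f 0 = 0" using f(2)[of 0 0] by simp
  have "(A *\<^sub>v map_vec f v) $ i = (\<Sum>j<n. A $$ (i, j) * f (v $ j))"
    using i A v by (simp add: scalar_prod_def atLeast0LessThan)
  also have "\<dots> = (\<Sum>j<n. f (A $$ (i, j) * v $ j))"
    using i A by (intro sum.cong) (auto simp: f(2) real_matD)
  also have "\<dots> = f (\<Sum>j<n. A $$ (i, j) * v $ j)"
    using sum_comp_morphism[of f "\<lambda>j. A $$ (i, j) * v $ j" "{..<n}"] f0 f(1) by (simp add: o_def)
  also have "(\<Sum>j<n. A $$ (i, j) * v $ j) = (A *\<^sub>v v) $ i"
    using i A v by (simp add: scalar_prod_def atLeast0LessThan)
  also have "f \<dots> = (e \<cdot>\<^sub>v map_vec f v) $ i"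
    using i v e by (simp add: Av f(2))
  finally show "(A *\<^sub>v map_vec f v) $ i = (e \<cdot>\<^sub>v map_vec f v) $ i" .
qed (use A v in simp)

lemma hermitian_mat_unit_eigenvector:
  assumes A: "A \<in> carrier_mat n n" "hermitian_mat A" and ev: "eigenvalue A e"
  obtains v where "v \<in> carrier_vec n" "v \<bullet>c v = 1" "A *\<^sub>v v = e \<cdot>\<^sub>v v"
    "elements_mat A \<subseteq> \<real> \<Longrightarrow> set\<^sub>v v \<subseteq> \<real>"
proof -
  obtain v0 where ev0: "eigenvector A v0 e" using ev by (auto simp: eigenvalue_def)
  then have v0: "v0 \<in> carrier_vec n" "v0 \<noteq> 0\<^sub>v n" "A *\<^sub>v v0 = e \<cdot>\<^sub>v v0"
    using A by (auto simp: eigenvector_def)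
  have e: "e \<in> \<real>" using hermitian_mat_eigenvalue_real[OF A ev0] .
  have "\<exists>v. v \<in> carrier_vec n \<and> v \<noteq> 0\<^sub>v n \<and> A *\<^sub>v v = e \<cdot>\<^sub>v v \<and>
    (elements_mat A \<subseteq> \<real> \<longrightarrow> set\<^sub>v v \<subseteq> \<real>)"
  proof (cases "elements_mat A \<subseteq> \<real>")
    case True
    let ?r = "map_vec (\<lambda>z. complex_of_real (Re z)) v0" and ?i = "map_vec (\<lambda>z. complex_of_real (Im z)) v0"
    have eig: "A *\<^sub>v ?r = e \<cdot>\<^sub>v ?r" "A *\<^sub>v ?i = e \<cdot>\<^sub>v ?i"
      by (rule real_mat_eigenvector_map[OF A(1) True e v0(1) v0(3)]; auto elim!: Reals_cases)+
    \<comment> \<open>A nonzero complex eigenvector of a real matrix has a nonzero real or imaginary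
      part, and either one is a real eigenvector for the same real eigenvalue.\<close>
    have "?r \<noteq> 0\<^sub>v n \<or> ?i \<noteq> 0\<^sub>v n"
    proof (rule ccontr)
      assume "\<not> ?thesis"
      then have 0: "?r = 0\<^sub>v n" "?i = 0\<^sub>v n" by auto
      have "v0 $ k = 0" if "k < n" for k
        using arg_cong[OF 0(1), of "\<lambda>u. u $ k"] arg_cong[OF 0(2), of "\<lambda>u. u $ k"] that v0(1)
        by (auto simp: complex_eq_iff)
      then show False using v0(1,2) by (auto intro!: eq_vecI)
    qed
    moreover have "set\<^sub>v ?r \<subseteq> \<real>" "set\<^sub>v ?i \<subseteq> \<real>" by auto
    moreover have "?r \<in> carrier_vec n" "?i \<in> carrier_vec n" using v0(1) by auto
    ultimately show ?thesis using eig by blast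
  qed (use v0 in auto)
  then obtain v where v: "v \<in> carrier_vec n" "v \<noteq> 0\<^sub>v n" "A *\<^sub>v v = e \<cdot>\<^sub>v v"
    "elements_mat A \<subseteq> \<real> \<longrightarrow> set\<^sub>v v \<subseteq> \<real>" by blast
  define r where "r = (\<Sum>i<n. (cmod (v $ i))\<^sup>2)"
  have vv: "v \<bullet>c v = of_real r" using v(1) by (simp add: r_def cscalar_prod_self_eq_norm)
  have "r \<noteq> 0" using vv v(1,2) by auto
  moreover have "r \<ge> 0" by (simp add: r_def sum_nonneg)
  ultimately have r: "r > 0" by simp
  \<comment> \<open>Normalizing by a real factor keeps a real eigenvector real.\<close>
  let ?c = "complex_of_real (1 / sqrt r)"
  show thesis
  proof (rule that[of "?c \<cdot>\<^sub>v v"])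
    have "(?c \<cdot>\<^sub>v v) \<bullet>c (?c \<cdot>\<^sub>v v) = ?c * (?c * (v \<bullet>c v))"
      using v(1) by (simp add: conjugate_smult_vec)
    also have "\<dots> = of_real (1 / sqrt r * (1 / sqrt r * r))"
      by (simp only: vv of_real_mult)
    also have "1 / sqrt r * (1 / sqrt r * r) = 1"
      using r by (simp add: field_simps)
    finally show "(?c \<cdot>\<^sub>v v) \<bullet>c (?c \<cdot>\<^sub>v v) = 1" by simp
    show "A *\<^sub>v (?c \<cdot>\<^sub>v v) = e \<cdot>\<^sub>v (?c \<cdot>\<^sub>v v)"
      using A v by (simp add: mult_mat_vec[of _ n n] smult_smult_assoc mult.commute)
    show "set\<^sub>v (?c \<cdot>\<^sub>v v) \<subseteq> \<real>" if "elements_mat A \<subseteq> \<real>"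
      using v(4) that by (auto elim!: vec_setE simp: subset_iff vec_setI intro!: Reals_divide)
  qed (use v in auto)
qed

text \<open>With a constant \<open>d\<close> the whole space is a single level set, so the block
  reflection is one reflection carrying the unit vector \<open>unit_vec n 0\<close> to the unit
  vector \<open>v\<close>.\<close>

lemma unitary_mat_with_first_column:
  assumes v: "v \<in> carrier_vec n" "v \<bullet>c v = 1" and n: "n > 0"
  obtains W where "W \<in> carrier_mat n n" "unitary_mat W" "W *\<^sub>v unit_vec n 0 = v"
    "set\<^sub>v v \<subseteq> \<real> \<Longrightarrow> elements_mat W \<subseteq> \<real>"
proof -
  let ?W = "block_reflection n (\<lambda>_. 0) (unit_vec n 0) v"
  let ?e = "unit_vec n 0 :: complex vec"
  have "(\<Sum>m | m < n \<and> 0 = c. ?e $ m * cnj (?e $ m)) = (\<Sum>m | m < n \<and> 0 = c. v $ m * cnj (v $ m))"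
    for c :: complex
  proof (cases "c = 0")
    \<comment> \<open>Only \<open>c = 0\<close> has a nonempty index set; there both sums are
      1.\<close>
    case True
    have "(\<Sum>m<n. ?e $ m * cnj (?e $ m)) = (\<Sum>m<n. if m = 0 then 1 else 0)"
      by (rule sum.cong) auto
    then have "(\<Sum>m<n. ?e $ m * cnj (?e $ m)) = 1" using n by simp
    moreover have "(\<Sum>m<n. v $ m * cnj (v $ m)) = 1"
      using v by (simp add: scalar_prod_def atLeast0LessThan)
    ultimately show ?thesis using True by (simp add: lessThan_def)
  qed auto
  note W = block_reflection_unitary[where n = n and d = "\<lambda>_. 0", OF this unit_vec_carrier v(1)]
  have "set\<^sub>v ?e \<subseteq> \<real>" by (auto elim!: vec_setE simp: unit_vec_def)
  then have "set\<^sub>v v \<subseteq> \<real> \<Longrightarrow> elements_mat ?W \<subseteq> \<real>"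
    by (intro block_reflection_real[OF unit_vec_carrier v(1)])
  with W show thesis by (intro that[of ?W]) auto
qed

text \<open>The eigenvalues may be listed in any prescribed order, so that matrices with equal characteristic
  polynomials receive the same diagonal form.\<close>

theorem hermitian_mat_diagonalization:
  assumes "A \<in> carrier_mat n n" "hermitian_mat A" "char_poly A = (\<Prod>e\<leftarrow>es. [:- e, 1:])"
  shows "\<exists>W \<in> carrier_mat n n. unitary_mat W \<and> A * W = W * mat_diag n (\<lambda>i. es ! i) \<and>
    (elements_mat A \<subseteq> \<real> \<longrightarrow> elements_mat W \<subseteq> \<real>)"
  using assms
proof (induction es arbitrary: n A)
  case Nil
  then have "n = 0" using degree_monic_char_poly[of A n] by simp
  then show ?case using Nil(1)
    by (intro bexI[of _ "1\<^sub>m 0"]) (auto simp: mat_diag_def intro!: unitary_matI[of _ 0] eq_matI)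
next
  case (Cons e es)
  note A = Cons.prems(1,2)
  have "degree (char_poly A) = Suc (length es)"
    using degree_linear_factors[of uminus "e # es"] Cons.prems(3) by simp
  then obtain m where n: "n = Suc m" using degree_monic_char_poly[OF A(1)] by auto
  have "eigenvalue A e"
    unfolding eigenvalue_root_char_poly[OF A(1)] Cons.prems(3) by simp
  then obtain v where v: "v \<in> carrier_vec n" "v \<bullet>c v = 1" "A *\<^sub>v v = e \<cdot>\<^sub>v v"
    "elements_mat A \<subseteq> \<real> \<Longrightarrow> set\<^sub>v v \<subseteq> \<real>"
    using hermitian_mat_unit_eigenvector[OF A] by blast
  obtain W0 where W0: "W0 \<in> carrier_mat n n" "unitary_mat W0" "W0 *\<^sub>v unit_vec n 0 = v"
    "set\<^sub>v v \<subseteq> \<real> \<Longrightarrow> elements_mat W0 \<subseteq> \<real>"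
    using unitary_mat_with_first_column[OF v(1,2)] n by blast
  note uW0 = unitary_matD[OF W0(2,1)]
  let ?Wa = "mat_adjoint W0"
  have Wa: "?Wa \<in> carrier_mat n n" using W0(1) by simp
  \<comment> \<open>Conjugation by \<open>W0\<close>, which maps \<open>unit_vec n 0\<close> to
    \<open>v\<close>, keeps the matrix Hermitian and makes \<open>unit_vec n 0\<close> an
    eigenvector for \<open>e\<close>. Column 0 and, by symmetry, row 0 therefore vanish off the
    corner, leaving a smaller Hermitian block.\<close>
  define A' where "A' = ?Wa * A * W0"
  have A': "A' \<in> carrier_mat n n" using A W0(1) by (simp add: A'_def mult_carrier_mat[of _ n n _ n])
  have WA': "W0 * A' = A * W0"
  proof -
    have "W0 * A' = (W0 * ?Wa) * A * W0"
      using A(1) W0(1) Wa by (simp add: A'_def assoc_mult_mat[of _ n n _ n _ n] mult_carrier_mat[of _ n n _ n])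
    then show ?thesis using A(1) by (simp add: uW0)
  qed
  have herm: "hermitian_mat A'"
    using A A' W0(1) Wa
    by (simp add: hermitian_mat_def A'_def mat_adjoint_mult[of _ n n _ n] assoc_mult_mat[of _ n n _ n _ n]
        mult_carrier_mat[of _ n n _ n])
  have col0: "A' $$ (i, 0) = (if i = 0 then e else 0)" if "i < n" for i
  proof -
    have "A' *\<^sub>v unit_vec n 0 = ?Wa *\<^sub>v (A *\<^sub>v (W0 *\<^sub>v unit_vec n 0))"
      using A(1) W0(1) Wa by (simp add: A'_def assoc_mult_mat_vec[of _ n n _ n] mult_carrier_mat[of _ n n _ n])
    also have "\<dots> = e \<cdot>\<^sub>v (?Wa *\<^sub>v (W0 *\<^sub>v unit_vec n 0))"
      using Wa v(1) by (simp add: W0(3) v(3) mult_mat_vec[of _ n n])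
    also have "?Wa *\<^sub>v (W0 *\<^sub>v unit_vec n 0) = unit_vec n 0"
      using uW0 by (simp flip: assoc_mult_mat_vec[OF Wa W0(1)])
    finally have "(A' *\<^sub>v unit_vec n 0) $ i = (e \<cdot>\<^sub>v unit_vec n 0) $ i" by simp
    moreover have "(A' *\<^sub>v unit_vec n 0) $ i = A' $$ (i, 0)"
      using that A' n by simp
    ultimately show ?thesis using that n by (auto split: if_splits)
  qed
  have row0: "A' $$ (0, j) = (if j = 0 then e else 0)" if "j < n" for j
  proof (cases "j = 0")
    case False
    then show ?thesis
      using hermitian_mat_index[OF herm, of 0 j] col0[OF that] A' n that by simp
  qed (use col0[OF that] in simp)
  define B where "B = mat m m (\<lambda>(i, j). A' $$ (Suc i, Suc j))"
  define E where "E = mat 1 1 (\<lambda>_. e)"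
  have B: "B \<in> carrier_mat m m" and E: "E \<in> carrier_mat 1 1" by (auto simp: B_def E_def)
  have block: "A' = four_block_mat E (0\<^sub>m 1 m) (0\<^sub>m m 1) B"
    using A' n by (intro eq_matI) (auto simp: E_def B_def col0 row0)
  have hermB: "hermitian_mat B"
    unfolding hermitian_mat_def
  proof
    show "mat_adjoint B = B"
      using A' n by (intro eq_matI) (auto simp: B_def intro!: hermitian_mat_index[OF herm, symmetric])
  qed (use B in simp)
  have "similar_mat A' A"
    using A W0(1) Wa A' uW0 by (intro similar_matI[of _ _ ?Wa W0 n]) (auto simp: A'_def)
  \<comment> \<open>Similarity preserves the characteristic polynomial and the block form splits off
    \<open>[:- e, 1:]\<close>; cancelling it leaves the list \<open>es\<close> in its order for
    \<open>B\<close>, as the induction needs.\<close>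
  from char_poly_similar[OF this] have "char_poly A' = [:- e, 1:] * (\<Prod>e\<leftarrow>es. [:- e, 1:])"
    by (simp add: Cons.prems(3))
  moreover have "char_poly A' = char_poly E * char_poly B"
    unfolding block by (rule char_poly_four_block_zeros_col) (use B E in auto)
  moreover have "char_poly E = [:- e, 1:]"
    by (simp add: E_def char_poly_defs det_def sign_def)
  ultimately have "char_poly B = (\<Prod>e\<leftarrow>es. [:- e, 1:])"
    by (metis mult_cancel_left pCons_eq_0_iff zero_neq_one)
  from Cons.IH[OF B hermB this] obtain V where V: "V \<in> carrier_mat m m" "unitary_mat V"
    "B * V = V * mat_diag m (\<lambda>i. es ! i)" "elements_mat B \<subseteq> \<real> \<longrightarrow> elements_mat V \<subseteq> \<real>"
    by blast
  \<comment> \<open>Bordering \<open>V\<close> by 1 leaves the corner \<open>e\<close> untouched;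
    \<open>W0 * F\<close> will diagonalize \<open>A\<close>.\<close>
  define F where "F = four_block_mat (1\<^sub>m 1) (0\<^sub>m 1 m) (0\<^sub>m m 1) V"
  have F: "F \<in> carrier_mat n n" using V(1) n by (auto simp: F_def)
  have adjF: "mat_adjoint F = four_block_mat (1\<^sub>m 1) (0\<^sub>m 1 m) (0\<^sub>m m 1) (mat_adjoint V)"
    using V(1) by (intro eq_matI) (auto simp: F_def)
  have uF: "unitary_mat F"
  proof (rule unitary_matI[OF F])
    have "F * mat_adjoint F = four_block_mat (1\<^sub>m 1) (0\<^sub>m 1 m) (0\<^sub>m m 1) (1\<^sub>m m)"
      unfolding F_def adjF[unfolded F_def]
      by (subst mult_four_block_mat[of _ 1 1 _ m _ m _ _ 1 _ m]) (use V unitary_matD[OF V(2,1)] in auto)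
    then show "F * mat_adjoint F = 1\<^sub>m n" using n by simp
  qed
  define D where "D = mat_diag n (\<lambda>i. (e # es) ! i)"
  have D: "D \<in> carrier_mat n n" by (simp add: D_def)
  have Dblock: "D = four_block_mat E (0\<^sub>m 1 m) (0\<^sub>m m 1) (mat_diag m (\<lambda>i. es ! i))"
    using n by (intro eq_matI) (auto simp: D_def E_def mat_diag_def nth_Cons')
  have "A' * F = four_block_mat E (0\<^sub>m 1 m) (0\<^sub>m m 1) (B * V)"
    unfolding block F_def
    by (subst mult_four_block_mat[of _ 1 1 _ m _ m _ _ 1 _ m]) (use V B E in auto)
  moreover have "F * D = four_block_mat E (0\<^sub>m 1 m) (0\<^sub>m m 1) (V * mat_diag m (\<lambda>i. es ! i))"
    unfolding Dblock F_def
    by (subst mult_four_block_mat[of _ 1 1 _ m _ m _ _ 1 _ m])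
      (use V(1) E left_mult_zero_mat[of "mat_diag m ((!) es)" m m 1] in auto)
  ultimately have AF: "A' * F = F * D" by (simp add: V(3))
  have "A * (W0 * F) = W0 * (A' * F)"
    using assoc_mult_mat[OF A(1) W0(1) F] assoc_mult_mat[OF W0(1) A' F] WA' by metis
  then have "A * (W0 * F) = W0 * F * D"
    using W0(1) F D by (simp add: AF assoc_mult_mat[of _ n n _ n _ n])
  \<comment> \<open>A real \<open>A\<close> yields a real \<open>v\<close> and hence a real
    \<open>W0\<close>; then \<open>B\<close> is real, and the induction hypothesis supplies a real
    \<open>V\<close>.\<close>
  moreover have "elements_mat (W0 * F) \<subseteq> \<real>" if real: "elements_mat A \<subseteq> \<real>"
  proof -
    have W0r: "elements_mat W0 \<subseteq> \<real>" using W0(4) v(4) real by blast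
    have "elements_mat A' \<subseteq> \<real>"
      unfolding A'_def using A(1) W0(1) Wa W0r real
      by (intro real_mat_mult[of _ _ n n n] real_mat_adjoint) auto
    then have "elements_mat B \<subseteq> \<real>"
      using A' n by (intro real_matI[OF B]) (auto simp: B_def real_matD)
    then have "elements_mat V \<subseteq> \<real>" using V(4) by blast
    then have "elements_mat F \<subseteq> \<real>"
      using V(1) n by (intro real_matI[OF F]) (auto simp: F_def real_matD)
    then show ?thesis using real_mat_mult[OF W0r _ W0(1) F] by blast
  qed
  ultimately show ?case
    using unitary_mat_mult[OF W0(2,1) uF F] W0(1) F by (intro bexI[of _ "W0 * F"]) (auto simp: D_def)
qed

section \<open>The equivalence\<close>

text \<open>The witness \<open>W2 V W1*\<close> passes to the eigenbasis of \<open>M1\<close>,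
  reflects within the eigenspaces, and returns through the eigenbasis of \<open>M2\<close>. The
  reality clause is attached to this same witness.\<close>

lemma resolvent_form_eq_imp_unitary_intertwiner:
  assumes M1: "M1 \<in> carrier_mat n n" "hermitian_mat M1" and M2: "M2 \<in> carrier_mat n n" "hermitian_mat M2"
    and v1: "v1 \<in> carrier_vec n" and v2: "v2 \<in> carrier_vec n"
    and sim: "similar_mat M1 M2"
    and eq: "\<And>t. invertible_mat (char_mat_at M1 t) \<Longrightarrow> invertible_mat (char_mat_at M2 t) \<Longrightarrow>
      resolvent_form M1 v1 t = resolvent_form M2 v2 t"
  shows "\<exists>U \<in> carrier_mat n n. unitary_mat U \<and> U * M1 = M2 * U \<and> U *\<^sub>v v1 = v2 \<and>
    (elements_mat M1 \<subseteq> \<real> \<and> elements_mat M2 \<subseteq> \<real> \<and> set\<^sub>v v1 \<subseteq> \<real> \<and> set\<^sub>v v2 \<subseteq> \<real> \<longrightarrow>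
     elements_mat U \<subseteq> \<real>)"
proof -
  \<comment> \<open>Similar matrices share this factorization, so one list \<open>es\<close> orders
    the eigenvalues of both and gives a common diagonal matrix.\<close>
  obtain es where es: "char_poly M1 = (\<Prod>e\<leftarrow>es. [:- e, 1:])"
    using char_poly_factorized[OF M1(1)] by blast
  define d where "d k = es ! k" for k
  let ?D = "mat_diag n d"
  have D: "?D \<in> carrier_mat n n" by simp
  obtain W1 where W1: "W1 \<in> carrier_mat n n" "unitary_mat W1" "M1 * W1 = W1 * ?D"
    "elements_mat M1 \<subseteq> \<real> \<longrightarrow> elements_mat W1 \<subseteq> \<real>"
    using hermitian_mat_diagonalization[OF M1 es] unfolding d_def by blast
  obtain W2 where W2: "W2 \<in> carrier_mat n n" "unitary_mat W2" "M2 * W2 = W2 * ?D"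
    "elements_mat M2 \<subseteq> \<real> \<longrightarrow> elements_mat W2 \<subseteq> \<real>"
    using hermitian_mat_diagonalization[OF M2, of es] char_poly_similar[OF sim] es
    unfolding d_def by auto
  note u1 = unitary_matD[OF W1(2,1)] and u2 = unitary_matD[OF W2(2,1)]
  define w1 where "w1 = mat_adjoint W1 *\<^sub>v v1"
  define w2 where "w2 = mat_adjoint W2 *\<^sub>v v2"
  let ?Wa = "mat_adjoint W1"
  have Wa: "?Wa \<in> carrier_mat n n" "mat_adjoint W2 \<in> carrier_mat n n" using W1(1) W2(1) by simp_all
  have w: "w1 \<in> carrier_vec n" "w2 \<in> carrier_vec n"
    using Wa v1 v2 by (simp_all add: w1_def w2_def)
  \<comment> \<open>Off the eigenvalues both shifted matrices are invertible, so \<open>eq\<close>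
    applies and the difference of the two partial fractions vanishes; its residues compare the norms
    on each eigenspace.\<close>
  have "(\<Sum>k<n. (w1 $ k * cnj (w1 $ k) - w2 $ k * cnj (w2 $ k)) / (t - d k)) = 0"
    if t: "t \<notin> d ` {..<n}" for t
    using resolvent_form_diagonalized[OF M1(1) W1(1,2,3) v1 t]
      resolvent_form_diagonalized[OF M2(1) W2(1,2,3) v2 t] eq[of t]
    by (simp add: diff_divide_distrib sum_subtractf w1_def w2_def)
  from partial_fractions_zero_imp_residues_zero[OF this]
  have norm: "(\<Sum>m | m < n \<and> d m = c. w1 $ m * cnj (w1 $ m)) =
      (\<Sum>m | m < n \<and> d m = c. w2 $ m * cnj (w2 $ m))" for c
    by (simp add: sum_subtractf)
  define V where "V = block_reflection n d w1 w2"
  have V: "V \<in> carrier_mat n n" "unitary_mat V" "V *\<^sub>v w1 = w2" "V * ?D = ?D * V"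
    using block_reflection_unitary[OF norm w] block_reflection_commute by (simp_all add: V_def)
  define U where "U = W2 * (V * ?Wa)"
  have U: "U \<in> carrier_mat n n" using W2(1) V(1) Wa by (simp add: U_def)
  have "unitary_mat U"
    unfolding U_def using V W2(1,2) W1(1,2) Wa
    by (intro unitary_mat_mult[of _ n] unitary_mat_adjoint[of _ n]) auto
  moreover have "U * M1 = M2 * U"
  proof -
    have "?Wa * M1 = ?Wa * (M1 * W1) * ?Wa"
      using M1(1) W1(1) Wa u1 by (simp add: assoc_mult_mat[of _ n n _ n _ n] mult_carrier_mat[of _ n n _ n])
    also have "\<dots> = (?Wa * W1) * ?D * ?Wa"
      using W1(1) Wa by (simp add: W1(3) assoc_mult_mat[of _ n n _ n _ n] mult_carrier_mat[of _ n n _ n])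
    finally have Wa1: "?Wa * M1 = ?D * ?Wa" by (simp add: u1 left_mult_one_mat[OF D])
    have "U * M1 = W2 * (V * (?Wa * M1))"
      using M1(1) W2(1) V(1) Wa by (simp add: U_def assoc_mult_mat[of _ n n _ n _ n] mult_carrier_mat[of _ n n _ n])
    also have "\<dots> = W2 * ((V * ?D) * ?Wa)"
      using V(1) Wa by (simp add: Wa1 assoc_mult_mat[of _ n n _ n _ n] mult_carrier_mat[of _ n n _ n])
    also have "\<dots> = (W2 * ?D) * (V * ?Wa)"
      using W2(1) V(1) Wa by (simp add: V(4) assoc_mult_mat[of _ n n _ n _ n] mult_carrier_mat[of _ n n _ n])
    also have "\<dots> = M2 * U"
      using M2(1) W2(1) V(1) Wa
      by (simp add: U_def assoc_mult_mat[of _ n n _ n _ n] mult_carrier_mat[of _ n n _ n] flip: W2(3))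
    finally show ?thesis .
  qed
  moreover have "U *\<^sub>v v1 = v2"
  proof -
    have "U *\<^sub>v v1 = W2 *\<^sub>v w2"
      using W2(1) V(1) Wa v1
      by (simp add: U_def assoc_mult_mat_vec[of _ n n _ n] mult_carrier_mat[of _ n n _ n] V(3) flip: w1_def)
    also have "\<dots> = v2"
      using u2 v2 by (simp add: w2_def flip: assoc_mult_mat_vec[OF W2(1) Wa(2)])
    finally show ?thesis .
  qed
  moreover have "elements_mat U \<subseteq> \<real>"
    if "elements_mat M1 \<subseteq> \<real>" "elements_mat M2 \<subseteq> \<real>" "set\<^sub>v v1 \<subseteq> \<real>" "set\<^sub>v v2 \<subseteq> \<real>"
  proof -
    have r: "elements_mat W1 \<subseteq> \<real>" "elements_mat W2 \<subseteq> \<real>" using that W1(4) W2(4) by auto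
    have "set\<^sub>v w1 \<subseteq> \<real>"
      unfolding w1_def using real_mult_mat_vec[OF real_mat_adjoint[OF r(1)] that(3) Wa(1) v1] .
    moreover have "set\<^sub>v w2 \<subseteq> \<real>"
      unfolding w2_def using real_mult_mat_vec[OF real_mat_adjoint[OF r(2)] that(4) Wa(2) v2] .
    ultimately have "elements_mat V \<subseteq> \<real>"
      unfolding V_def using w by (intro block_reflection_real)
    then show ?thesis
      unfolding U_def using r V(1) Wa W2(1)
      by (intro real_mat_mult[of _ _ n n n] real_mat_adjoint) auto
  qed
  ultimately show ?thesis using U by blast
qed

lemma unitary_real_imp_real_orthogonal:
  assumes "unitary_mat U" "elements_mat U \<subseteq> \<real>"
  shows "real_orthogonal_mat U"
proof -
  have "mat_adjoint U = transpose_mat U"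
    using assms(2) by (intro eq_matI) (auto simp: Reals_cnj_iff[symmetric] real_matD)
  then show ?thesis using assms by (simp add: unitary_mat_def real_orthogonal_mat_def)
qed

lemma unitary_intertwiner_imp_similar_rank_one:
  assumes M: "M1 \<in> carrier_mat n n" "M2 \<in> carrier_mat n n"
    and v: "v1 \<in> carrier_vec n" "v2 \<in> carrier_vec n"
    and U: "U \<in> carrier_mat n n" "unitary_mat U" "U * M1 = M2 * U" "U *\<^sub>v v1 = v2"
  shows "similar_mat (outer_prod v1 v1 - M1) (outer_prod v2 v2 - M2)"
proof (rule similar_mat_sym, rule similar_matI[of _ _ U "mat_adjoint U" n])
  let ?Ua = "mat_adjoint U"
  have Ua: "?Ua \<in> carrier_mat n n" using U(1) by simp
  note u = unitary_matD[OF U(2,1)]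
  have O: "outer_prod v1 v1 \<in> carrier_mat n n" using v by simp
  have left: "U * outer_prod v1 v1 = outer_prod v2 v1"
    using U(1) v(1) by (intro eq_matI) (auto simp: outer_prod_def scalar_prod_def sum_distrib_right sum_distrib_left mult_ac simp flip: U(4))
  have right: "outer_prod z v1 * ?Ua = outer_prod z v2" if "z \<in> carrier_vec n" for z
    using U(1) v that by (intro eq_matI)
      (auto simp: outer_prod_def scalar_prod_def sum_distrib_left mult_ac simp flip: U(4))
  have "U * (outer_prod v1 v1 - M1) * ?Ua = (outer_prod v2 v1 - M2 * U) * ?Ua"
    using U(1) M(1) O by (simp add: mult_minus_distrib_mat[of _ n n _ n] left U(3))
  also have "\<dots> = outer_prod v2 v2 - M2 * U * ?Ua"
    using U(1) M(2) v Ua by (simp add: minus_mult_distrib_mat[of _ n n _ _ n] right[OF v(2)] mult_carrier_mat[of _ n n _ n])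
  also have "M2 * U * ?Ua = M2"
    using U(1) M(2) Ua u by (simp add: assoc_mult_mat[of _ n n _ n _ n])
  finally show "outer_prod v2 v2 - M2 = U * (outer_prod v1 v1 - M1) * ?Ua" ..
qed (use unitary_matD[OF U(2,1)] U M v in auto)

theorem theorem5p1:
  fixes n :: nat and M1 M2 :: "complex mat" and v1 v2 :: "complex vec"
  assumes "M1 \<in> carrier_mat n n" and "M2 \<in> carrier_mat n n"
    and "v1 \<in> carrier_vec n" and "v2 \<in> carrier_vec n"
    and "hermitian_mat M1" and "hermitian_mat M2"
    and "similar_mat M1 M2"
  shows "(similar_mat (outer_prod v1 v1 - M1) (outer_prod v2 v2 - M2) \<longleftrightarrow>
          (\<forall>t. invertible_mat (char_mat_at M1 t) \<and> invertible_mat (char_mat_at M2 t) \<longrightarrow>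
             resolvent_form M1 v1 t = resolvent_form M2 v2 t))
       \<and> ((\<forall>t. invertible_mat (char_mat_at M1 t) \<and> invertible_mat (char_mat_at M2 t) \<longrightarrow>
             resolvent_form M1 v1 t = resolvent_form M2 v2 t) \<longleftrightarrow>
          (\<exists>U \<in> carrier_mat n n. unitary_mat U \<and> U * M1 = M2 * U \<and> U *\<^sub>v v1 = v2))
       \<and> (elements_mat M1 \<subseteq> \<real> \<and> elements_mat M2 \<subseteq> \<real> \<and>
          set\<^sub>v v1 \<subseteq> \<real> \<and> set\<^sub>v v2 \<subseteq> \<real> \<longrightarrow>
          (\<exists>U \<in> carrier_mat n n. unitary_mat U \<and> U * M1 = M2 * U \<and> U *\<^sub>v v1 = v2) \<longrightarrow>
          (\<exists>U \<in> carrier_mat n n. unitary_mat U \<and> real_orthogonal_mat U \<and>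
             U * M1 = M2 * U \<and> U *\<^sub>v v1 = v2))"
proof -
  let ?a = "similar_mat (outer_prod v1 v1 - M1) (outer_prod v2 v2 - M2)"
  let ?b = "\<forall>t. invertible_mat (char_mat_at M1 t) \<and> invertible_mat (char_mat_at M2 t) \<longrightarrow>
             resolvent_form M1 v1 t = resolvent_form M2 v2 t"
  let ?c = "\<exists>U \<in> carrier_mat n n. unitary_mat U \<and> U * M1 = M2 * U \<and> U *\<^sub>v v1 = v2"
  have ca: "?c \<Longrightarrow> ?a"
    using unitary_intertwiner_imp_similar_rank_one[OF assms(1-4)] by blast
  have ab: "?a \<Longrightarrow> ?b"
    using similar_rank_one_imp_resolvent_form_eq[OF assms(1-4,7)] by blast
  \<comment> \<open>Stronger than the step from (b) to (c): the reality clause is kept for the final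
    claim.\<close>
  have bc: "?b \<Longrightarrow> \<exists>U \<in> carrier_mat n n. unitary_mat U \<and> U * M1 = M2 * U \<and> U *\<^sub>v v1 = v2 \<and>
    (elements_mat M1 \<subseteq> \<real> \<and> elements_mat M2 \<subseteq> \<real> \<and> set\<^sub>v v1 \<subseteq> \<real> \<and> set\<^sub>v v2 \<subseteq> \<real> \<longrightarrow>
     elements_mat U \<subseteq> \<real>)"
    using resolvent_form_eq_imp_unitary_intertwiner[OF assms(1,5,2,6,3,4,7)] by blast
  show ?thesis
  proof (intro conjI impI)
    show "?a \<longleftrightarrow> ?b" using ca ab bc by blast
    show "?b \<longleftrightarrow> ?c" using ca ab bc by blast
    assume real: "elements_mat M1 \<subseteq> \<real> \<and> elements_mat M2 \<subseteq> \<real> \<and> set\<^sub>v v1 \<subseteq> \<real> \<and> set\<^sub>v v2 \<subseteq> \<real>"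
      and c: ?c
    \<comment> \<open>The intertwiner given by (c) may be non-real, so a new one is built by going
      round through (a) and (b).\<close>
    from bc[OF ab[OF ca[OF c]]] obtain U
      where U: "U \<in> carrier_mat n n" "unitary_mat U" "U * M1 = M2 * U" "U *\<^sub>v v1 = v2"
        and "elements_mat M1 \<subseteq> \<real> \<and> elements_mat M2 \<subseteq> \<real> \<and> set\<^sub>v v1 \<subseteq> \<real> \<and> set\<^sub>v v2 \<subseteq> \<real> \<longrightarrow>
          elements_mat U \<subseteq> \<real>"
      by (elim bexE conjE) rule
    from this(5) real have "elements_mat U \<subseteq> \<real>" by (rule mp)
    with U show "\<exists>U \<in> carrier_mat n n. unitary_mat U \<and> real_orthogonal_mat U \<and>
             U * M1 = M2 * U \<and> U *\<^sub>v v1 = v2"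
      by (intro bexI[of _ U] conjI unitary_real_imp_real_orthogonal)
  qed
qed

end
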